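(* Let $q$ be a prime power and $n\ge 2$ an integer. Let $\omega_{q,n}$ denote the largest value of $\omega(G_U)$ as $U$ runs over all $\mathbb{F}_q$-vector spaces $U\subsetneq \mathbb{F}_{q^n}$. Then: (1) $\omega_{2,n}=n+1$ for $n=2,3,4,5$; (2) if $q>2$ or $n\ge 6$, then $\omega_{q,n}=q^{(n-1)/2}+1$ if $n$ is odd and $\omega_{q,n}=q^{n/2}$ if $n$ is even.
   Context: $\mathbb{F}_{q^n}$ is regarded as an $n$-dimensional vector space over $\mathbb{F}_q$. For an $\mathbb{F}_q$-vector subspace $U\subsetneq \mathbb{F}_{q^n}$, $G_U$ is the undirected graph with vertex set $\mathbb{F}_{q^n}$ in which distinct $a,b\in\mathbb{F}_{q^n}$ are adjacent if and only if $ab\in U$. $\omega(G_U)$ denotes the clique number of $G_U$ (the largest size of a set of pairwise adjacent vertices). *)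

theory Defs
  imports Complex_Main "HOL-Library.Cardinality" "HOL-Library.Ramsey" "HOL-Number_Theory.Prime_Powers"
begin

text \<open>A simple graph is given by a vertex set \<open>V\<close> and a set \<open>E\<close> of two-element subsets of \<open>V\<close>,
  as in \<^const>\<open>clique\<close>. The maximum is meaningful for finite \<open>V\<close>.\<close>

definition clique_number :: "'a set \<Rightarrow> 'a set set \<Rightarrow> nat" where
  "clique_number V E = Max {card C | C. C \<subseteq> V \<and> clique C E}"

definition product_graph_edges :: "'a::field set \<Rightarrow> 'a set set" where
  "product_graph_edges U = {{a, b} | a b. a \<noteq> b \<and> a * b \<in> U}"

text \<open>The extension of finite fields is given by a field homomorphism
  \<open>\<iota> :: 'k \<Rightarrow> 'a\<close>, which makes \<open>'a\<close> a vector space over \<open>'k\<close> with scalar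
  multiplication \<open>c x \<mapsto> \<iota> c * x\<close>.\<close>

definition max_product_clique_number :: "('k::field \<Rightarrow> 'a::field) \<Rightarrow> nat" where
  "max_product_clique_number \<iota> =
     Max {clique_number UNIV (product_graph_edges U) | U.
            module.subspace (\<lambda>c x. \<iota> c * x) U \<and> U \<subset> UNIV}"

end

theory Submission
  imports Defs "HOL-Algebra.Multiplicative_Group"
begin

text \<open>
  A proper subspace lies in the kernel of a nonzero functional \<open>f\<close>, so a clique is a set of
  pairwise orthogonal vectors for the nondegenerate symmetric form \<open>(x, y) \<mapsto> f (x * y)\<close>.
  If \<open>k\<close> of its members are anisotropic and the others span a subspace of dimension \<open>d\<close>, then
  this subspace is totally isotropic and orthogonal to a subspace of dimension \<open>d + k\<close>, so
  \<open>2 * d + k \<le> n\<close> and the clique has at most \<open>q ^ d + k\<close> members.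
  Conversely, if \<open>1, t, \<dots>, t ^ (n - 1)\<close> is a basis, let \<open>U\<close> be the span of
  \<open>1, t, \<dots>, t ^ (n - 2)\<close>; the span of \<open>1, \<dots>, t ^ (n div 2 - 1)\<close> is a clique, and for odd \<open>n\<close>
  the vertex \<open>t ^ (n div 2)\<close> can be added. For \<open>q = 2\<close> the form admits an
  orthonormal basis, which together with \<open>0\<close> is a clique of size \<open>n + 1\<close>.
\<close>

section \<open>Primitive elements, and cliques of product graphs\<close>

lemma finite_field_has_primitive_element:
  "\<exists>t::'a::{field,finite}. \<forall>x. x \<noteq> 0 \<longrightarrow> (\<exists>i::nat. x = t ^ i)"
proof -
  \<comment> \<open>Cyclicity of the multiplicative group is stated for carrier-based fields, so the
    type is packed as a ring with carrier \<open>UNIV\<close>.\<close>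
  define K :: "'a ring" where
    "K = \<lparr>carrier = UNIV, monoid.mult = (*), one = 1, ring.zero = 0, add = (+)\<rparr>"
  have inverses: "\<exists>y. y + x = 0" "x \<noteq> 0 \<Longrightarrow> \<exists>y. y * x = 1" for x :: 'a
    by (auto intro: exI[of _ "- x"] exI[of _ "inverse x"])
  interpret K: field K
    by (rule cring.cring_fieldI2, unfold_locales)
      (use inverses in \<open>auto simp: K_def Units_def algebra_simps\<close>)
  have car: "carrier K = UNIV" and zero: "\<zero>\<^bsub>K\<^esub> = 0"
    by (simp_all add: K_def)
  have pow: "x [^]\<^bsub>K\<^esub> (i::nat) = x ^ i" for x i
    by (induction i) (simp_all add: K_def nat_pow_def mult.commute)
  have "finite (carrier K)"
    by simp
  then obtain t where "carrier (mult_of K) = {t [^]\<^bsub>K\<^esub> i | i::nat. i \<in> UNIV}"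
    using K.finite_field_mult_group_has_gen by blast
  then have "UNIV - {0} = {t ^ i | i::nat. i \<in> UNIV}"
    by (simp add: car zero pow)
  then show ?thesis
    by blast
qed

lemma edge_iff: "v \<noteq> w \<Longrightarrow> {v, w} \<in> product_graph_edges U \<longleftrightarrow> v * w \<in> U"
  by (auto simp: product_graph_edges_def doubleton_eq_iff mult.commute)

lemma clique_iff:
  "clique C (product_graph_edges U) \<longleftrightarrow> (\<forall>v\<in>C. \<forall>w\<in>C. v \<noteq> w \<longrightarrow> v * w \<in> U)"
  by (auto simp: clique_def edge_iff)

text \<open>Both maxima range over finite nonempty sets. The clique only has to reach
  \<open>M\<close>, since the upper bound then forces equality.\<close>

lemma max_product_clique_number_eqI:
  fixes \<iota> :: "'k::field \<Rightarrow> 'a::{field,finite}"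
  assumes upper: "\<And>U C. module.subspace (\<lambda>c x. \<iota> c * x) U \<Longrightarrow> U \<noteq> UNIV \<Longrightarrow>
      clique C (product_graph_edges U) \<Longrightarrow> card C \<le> M"
    and lower: "module.subspace (\<lambda>c x. \<iota> c * x) U" "U \<noteq> UNIV"
      "clique C (product_graph_edges U)" "M \<le> card C"
  shows "max_product_clique_number \<iota> = M"
proof -
  have fin: "finite {card C | C. C \<subseteq> UNIV \<and> clique C (product_graph_edges V)}" for V :: "'a set"
    by simp
  have le: "clique_number UNIV (product_graph_edges V) \<le> M"
    if "module.subspace (\<lambda>c x. \<iota> c * x) V" "V \<noteq> UNIV" for V
    unfolding clique_number_def
  proof (rule Max.boundedI[OF fin])
    show "{card C | C. C \<subseteq> UNIV \<and> clique C (product_graph_edges V)} \<noteq> {}"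
      by (auto intro!: exI[of _ "{}"] simp: clique_def)
  qed (use upper[OF that] in auto)
  have "M \<le> clique_number UNIV (product_graph_edges U)"
    unfolding clique_number_def
    by (rule order_trans[OF lower(4)], rule Max_ge[OF fin]) (use lower in auto)
  with le[OF lower(1,2)] have eq: "clique_number UNIV (product_graph_edges U) = M"
    by simp
  show ?thesis
    unfolding max_product_clique_number_def
  proof (rule Max_eqI)
    show "M \<in> {clique_number UNIV (product_graph_edges U) | U.
            module.subspace (\<lambda>c x. \<iota> c * x) U \<and> U \<subset> UNIV}"
      using lower eq by blast
  qed (use le in auto)
qed

section \<open>The extension field as a vector space over the base field\<close>

locale finite_field_extension =
  fixes \<iota> :: "'k::{field,finite} \<Rightarrow> 'a::{field,finite}"
  assumes hom_one: "\<iota> 1 = 1"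
    and hom_add: "\<And>x y. \<iota> (x + y) = \<iota> x + \<iota> y"
    and hom_mult: "\<And>x y. \<iota> (x * y) = \<iota> x * \<iota> y"
begin

sublocale vector_space "\<lambda>c x. \<iota> c * x"
  by unfold_locales (simp_all add: hom_one hom_add hom_mult algebra_simps)

text \<open>Each new basis vector \<open>b\<close> multiplies the size by that of the base field,
  because the decomposition \<open>\<iota> c * b + x\<close> with \<open>x\<close> in the old span
  is unique. Dimensions are compared through this count below.\<close>

lemma card_span_independent:
  assumes "independent B"
  shows "card (span B) = CARD('k) ^ card B"
proof -
  have "finite B" by simp
  then show ?thesis
    using assms
  proof (induction B rule: finite_induct)
    case empty
    then show ?case by simp
  next
    case (insert b B)
    then have ind: "independent B" and b: "b \<notin> span B"
      by (auto simp: independent_insert)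
    let ?h = "\<lambda>(c, x). \<iota> c * b + x"
    have inj: "inj_on ?h (UNIV \<times> span B)"
    proof (rule inj_onI, clarify)
      fix c x c' x'
      assume x: "x \<in> span B" "x' \<in> span B" and eq: "\<iota> c * b + x = \<iota> c' * b + x'"
      have "c = c'"
      proof (rule ccontr)
        assume "c \<noteq> c'"
        have "\<iota> (c - c') * b = x' - x"
          using eq hom_add[of "c - c'" c'] by (simp add: algebra_simps)
        then have "\<iota> (c - c') * b \<in> span B"
          using x by (simp add: span_diff)
        then have "\<iota> (inverse (c - c')) * (\<iota> (c - c') * b) \<in> span B"
          by (rule span_scale)
        moreover have "\<iota> (inverse (c - c')) * (\<iota> (c - c') * b) = b"
          using \<open>c \<noteq> c'\<close> hom_mult[of "inverse (c - c')" "c - c'"]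
          by (simp add: mult.assoc[symmetric] hom_one)
        ultimately show False
          using b by metis
      qed
      with eq show "c = c' \<and> x = x'"
        by simp
    qed
    have "span (insert b B) = ?h ` (UNIV \<times> span B)"
    proof (intro Set.set_eqI iffI)
      fix y assume "y \<in> span (insert b B)"
      then obtain c where "y - \<iota> c * b \<in> span B"
        by (auto simp: span_breakdown_eq)
      then show "y \<in> ?h ` (UNIV \<times> span B)"
        by (intro image_eqI[where x = "(c, y - \<iota> c * b)"]) auto
    next
      fix y assume "y \<in> ?h ` (UNIV \<times> span B)"
      then obtain c x where "y = \<iota> c * b + x" "x \<in> span B"
        by auto
      then show "y \<in> span (insert b B)"
        by (auto simp: span_breakdown_eq intro!: exI[of _ c])
    qed
    then have "card (span (insert b B)) = CARD('k) * card (span B)"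
      using card_image[OF inj] by (simp add: card_cartesian_product)
    then show ?case
      using insert ind by simp
  qed
qed

end

section \<open>The form of a nonzero functional, and the upper bound\<close>

text \<open>The type variables shift here: \<open>'a\<close> is now the base field and
  \<open>'b\<close> the extension, whereas in \<open>finite_field_extension\<close> the extension is
  \<open>'a\<close>.\<close>

locale field_functional = finite_field_extension +
  fixes f :: "'b::{field,finite} \<Rightarrow> 'a::{field,finite}"
  assumes f_add: "f (x + y) = f x + f y"
    and f_scale: "f (\<iota> c * x) = c * f x"
    and f_nonzero: "\<exists>x. f x \<noteq> 0"
begin

lemma f_0: "f 0 = 0"
  using f_scale[of 0 0] by simp

lemma f_diff: "f (x - y) = f x - f y"
  using f_add[of "x - y" y] by (simp add: algebra_simps)

lemma f_sum: "f (sum g A) = (\<Sum>x\<in>A. f (g x))"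
  by (induction A rule: infinite_finite_induct) (simp_all add: f_0 f_add)

lemma f_scale_mult: "f ((\<iota> c * x) * y) = c * f (x * y)" "f (y * (\<iota> c * x)) = c * f (y * x)"
  using f_scale[of c "x * y"] by (simp_all add: ac_simps)

text \<open>For nonzero \<open>w\<close> every field element is a multiple \<open>x * w\<close>, so
  \<open>f\<close> would vanish everywhere.\<close>

lemma nondegenerate:
  assumes "\<And>x. f (x * w) = 0"
  shows "w = 0"
proof (rule ccontr)
  assume "w \<noteq> 0"
  then have "f x = 0" for x
    using assms[of "x / w"] by simp
  with f_nonzero show False by simp
qed

lemma orthogonal_span:
  assumes "\<And>x. x \<in> S \<Longrightarrow> f (x * w) = 0" "y \<in> span S"
  shows "f (y * w) = 0"
  using assms(2)
proof (induction rule: span_induct_alt)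
  case (step c x y)
  then show ?case
    using assms(1)[of x] by (simp add: distrib_right f_add f_scale_mult)
qed (simp add: f_0)

text \<open>An anisotropic vector \<open>a\<close> is outside the span of vectors orthogonal to it,
  since membership would give \<open>f (a * a) = 0\<close>. The members of \<open>N\<close> can
  therefore be added to \<open>D\<close> one at a time.\<close>

lemma independent_orthogonal_Un:
  assumes "independent D"
    and aniso: "\<And>a. a \<in> N \<Longrightarrow> f (a * a) \<noteq> 0"
    and orth: "\<And>a b. a \<in> N \<Longrightarrow> b \<in> N \<union> D \<Longrightarrow> a \<noteq> b \<Longrightarrow> f (b * a) = 0"
    and disj: "N \<inter> D = {}"
  shows "independent (N \<union> D)"
proof -
  have "finite N" by simp
  then show ?thesis
    using aniso orth disj
  proof (induction N rule: finite_induct)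
    case empty
    then show ?case using assms(1) by simp
  next
    case (insert a N)
    have "f (b * a) = 0" if "b \<in> N \<union> D" for b
      using that insert by auto
    then have "a \<notin> span (N \<union> D)"
      using orthogonal_span[of "N \<union> D" a a] insert.prems(1)[of a] by blast
    moreover have "independent (N \<union> D)"
      using insert by simp
    ultimately show ?case
      by (simp add: independent_insertI)
  qed
qed

text \<open>The map \<open>w \<mapsto> f (\<cdot> * w)\<close> embeds \<open>span D\<close> into the functionals that vanish on \<open>P\<close>, and these
  are determined by their values on the rest of a basis extending \<open>P\<close>.\<close>

lemma orthogonal_dimension_bound:
  assumes "CARD('b) = CARD('a) ^ n" "independent D" "independent P"
    and orth: "\<And>x y. x \<in> D \<Longrightarrow> y \<in> P \<Longrightarrow> f (x * y) = 0"
  shows "card D + card P \<le> n"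
proof -
  have q: "CARD('a) > 1"
    using card_mono[of UNIV "{0, 1::'a}"] by simp
  define B where "B = extend_basis P"
  have B: "P \<subseteq> B" "independent B" "span B = UNIV"
    using assms(3) by (simp_all add: B_def extend_basis_superset independent_extend_basis)
  have cardB: "card B = n"
    using card_span_independent[OF B(2)] assms(1) B(3) q by simp
  let ?h = "\<lambda>w. restrict (\<lambda>b. f (b * w)) (B - P)"
  have "inj_on ?h (span D)"
  proof (rule inj_onI)
    fix w w' assume w: "w \<in> span D" "w' \<in> span D" and eq: "?h w = ?h w'"
    have "f (b * (w - w')) = 0" if b: "b \<in> B" for b
    proof (cases "b \<in> P")
      case True
      then have "f (w * b) = 0" "f (w' * b) = 0"
        using orthogonal_span[of D b] orth w by auto
      then show ?thesis
        by (simp add: right_diff_distrib f_diff mult.commute)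
    next
      case False
      then have "f (b * w) = f (b * w')"
        using fun_cong[OF eq, of b] b by simp
      then show ?thesis
        by (simp add: right_diff_distrib f_diff)
    qed
    then have "f (x * (w - w')) = 0" for x
      using orthogonal_span[of B "w - w'" x] B(3) by simp
    then show "w = w'"
      using nondegenerate[of "w - w'"] by simp
  qed
  moreover have "?h ` span D \<subseteq> (B - P) \<rightarrow>\<^sub>E UNIV"
    by (rule image_subsetI) simp
  ultimately have "card (span D) \<le> card ((B - P) \<rightarrow>\<^sub>E (UNIV :: 'a set))"
    by (intro card_inj_on_le[of ?h]) (auto intro: finite_PiE)
  also have "\<dots> = CARD('a) ^ (n - card P)"
    using B(1) cardB by (simp add: card_funcsetE card_Diff_subset)
  finally have "card D \<le> n - card P"
    using card_span_independent[OF assms(2)] q by simp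
  \<comment> \<open>The subtraction in \<open>n - card P\<close> is truncated, so this is required
    for the sum.\<close>
  moreover have "card P \<le> n"
    using card_mono[OF _ B(1)] cardB by simp
  ultimately show ?thesis
    by simp
qed

lemma pairwise_orthogonal_bound:
  assumes "CARD('b) = CARD('a) ^ n"
    and orth: "\<And>x y. x \<in> C \<Longrightarrow> y \<in> C \<Longrightarrow> x \<noteq> y \<Longrightarrow> f (x * y) = 0"
  shows "\<exists>d k. 2 * d + k \<le> n \<and> card C \<le> CARD('a) ^ d + k"
proof -
  define N where "N = {a \<in> C. f (a * a) \<noteq> 0}"
  define I where "I = {a \<in> C. f (a * a) = 0}"
  obtain D where D: "D \<subseteq> I" "independent D" "I \<subseteq> span D"
    by (rule maximal_independent_subset[of I])
  have disj: "N \<inter> D = {}"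
    using D(1) by (auto simp: N_def I_def)
  have "independent (N \<union> D)"
  proof (rule independent_orthogonal_Un[OF D(2) _ _ disj])
    fix a b assume "a \<in> N" "b \<in> N \<union> D" "a \<noteq> b"
    then show "f (b * a) = 0"
      using D(1) orth[of b a] by (auto simp: N_def I_def)
  qed (simp add: N_def)
  \<comment> \<open>Members of \<open>D\<close> are isotropic, so \<open>D\<close> is orthogonal to
    itself as well as to \<open>N\<close>; this is why \<open>d\<close> counts twice in the
    bound.\<close>
  moreover have "f (x * y) = 0" if "x \<in> D" "y \<in> N \<union> D" for x y
    using that D(1) orth[of x y] by (cases "x = y") (auto simp: N_def I_def)
  ultimately have "card D + card (N \<union> D) \<le> n"
    by (rule orthogonal_dimension_bound[OF assms(1) D(2)])
  then have "2 * card D + card N \<le> n"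
    using disj by (simp add: card_Un_disjoint)
  moreover have "card C \<le> CARD('a) ^ card D + card N"
  proof -
    have "C = I \<union> N"
      by (auto simp: N_def I_def)
    then have "card C \<le> card I + card N"
      by (simp add: card_Un_le)
    moreover have "card I \<le> card (span D)"
      using D(3) by (simp add: card_mono)
    ultimately show ?thesis
      using card_span_independent[OF D(2)] by simp
  qed
  ultimately show ?thesis
    by blast
qed

end

section \<open>From subspaces to functionals, and cliques from powers of a generator\<close>

context finite_field_extension
begin

text \<open>A basis of \<open>U\<close> stays independent after adding some \<open>a\<close> outside
  \<open>U\<close>; the functional sends \<open>a\<close> to 1 and that basis to 0.\<close>

lemma proper_subspace_in_kernel:
  assumes "subspace U" "U \<noteq> UNIV"
  shows "\<exists>f. field_functional \<iota> f \<and> (\<forall>x\<in>U. f x = 0)"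
proof -
  interpret P: vector_space_pair "\<lambda>c x. \<iota> c * x" "(*) :: 'k \<Rightarrow> 'k \<Rightarrow> 'k"
    by unfold_locales (simp_all add: algebra_simps)
  obtain B where B: "B \<subseteq> U" "independent B" "U \<subseteq> span B"
    by (rule maximal_independent_subset[of U])
  obtain a where a: "a \<notin> U"
    using assms(2) by blast
  have spB: "span B = U"
    using B assms(1) by (simp add: span_subspace)
  then have "independent (insert a B)"
    using B a by (simp add: independent_insertI)
  from P.linear_independent_extend[OF this, of "\<lambda>x. if x = a then 1 else 0"]
  obtain f where f: "Vector_Spaces.linear (\<lambda>c x. \<iota> c * x) ((*) :: 'k \<Rightarrow> 'k \<Rightarrow> 'k) f"
    and v: "\<forall>x\<in>insert a B. f x = (if x = a then 1 else 0)"
    by blast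
  have add: "f (x + y) = f x + f y" and scale: "f (\<iota> c * x) = c * f x" for x y c
    using P.linear_add[OF f] P.linear_scale[OF f] by simp_all
  have f0: "f 0 = 0"
    using scale[of 0 0] by simp
  have "f x = 0" if "x \<in> U" for x
    using that unfolding spB[symmetric]
  proof (induction rule: span_induct_alt)
    case (step c x y)
    have "x \<noteq> a"
      using step(1) B a by blast
    then show ?case
      using step v by (simp add: add scale)
  qed (simp add: f0)
  moreover have "field_functional \<iota> f"
    by unfold_locales (use add scale v in \<open>auto intro!: exI[of _ a]\<close>)
  ultimately show ?thesis
    by blast
qed

lemma clique_bound:
  assumes "CARD('a) = CARD('k) ^ n" "subspace U" "U \<noteq> UNIV" "clique C (product_graph_edges U)"
  shows "\<exists>d k. 2 * d + k \<le> n \<and> card C \<le> CARD('k) ^ d + k"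
proof -
  obtain f where "field_functional \<iota> f" and f: "\<forall>x\<in>U. f x = 0"
    using proper_subspace_in_kernel[OF assms(2,3)] by blast
  then interpret F: field_functional \<iota> f
    by blast
  show ?thesis
    by (rule F.pairwise_orthogonal_bound[OF assms(1)]) (use assms(4) f in \<open>auto simp: clique_iff\<close>)
qed

text \<open>If \<open>t ^ m\<close> lay in the span of the lower powers, that span would be closed
  under multiplication by \<open>t\<close>. It would then contain every nonzero element, yet for
  \<open>m < n\<close> it is too small to be the whole field.\<close>

lemma power_basis:
  assumes gen: "\<And>x. x \<noteq> 0 \<Longrightarrow> \<exists>i::nat. x = t ^ i"
    and "CARD('a) = CARD('k) ^ n" "m \<le> n"
  shows "independent ((^) t ` {..<m}) \<and> card ((^) t ` {..<m}) = m \<and>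
    (m < n \<longrightarrow> t ^ m \<notin> span ((^) t ` {..<m}))"
  using \<open>m \<le> n\<close>
proof (induction m)
  have q: "CARD('k) > 1"
    using card_mono[of UNIV "{0, 1::'k}"] by simp
  have notin: "t ^ m \<notin> span ((^) t ` {..<m})" (is "_ \<notin> span ?P")
    if "independent ((^) t ` {..<m})" "card ((^) t ` {..<m}) = m" "m < n" for m
  proof
    assume tm: "t ^ m \<in> span ?P"
    have shift: "t * x \<in> span ?P" if "x \<in> span ?P" for x
      using that
    proof (induction rule: span_induct_alt)
      case (step c x y)
      then obtain i where i: "i < m" "x = t ^ i"
        by auto
      have "t ^ Suc i \<in> span ?P"
      proof (cases "Suc i = m")
        case False
        with i show ?thesis
          by (intro span_base imageI) simp
      qed (use tm in simp)
      then have "t * x \<in> span ?P"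
        by (simp add: i)
      then have "\<iota> c * (t * x) + t * y \<in> span ?P"
        using step by (intro span_add span_scale)
      then show ?case
        by (simp add: algebra_simps)
    qed (simp add: span_zero)
    have pow: "t ^ i * t ^ m \<in> span ?P" for i
      by (induction i) (use tm shift in \<open>auto simp: mult.assoc\<close>)
    have "m > 0"
      using tm by (cases "m = 0") auto
    have "y \<in> span ?P" for y
    \<comment> \<open>Dividing by \<open>t ^ m\<close> requires \<open>t\<close> to be nonzero. If
      \<open>t = 0\<close>, its only nonzero power is 1, so the field is just
      \<open>{0, 1}\<close>.\<close>
    proof (cases "y = 0 \<or> t = 0")
      case True
      have "y \<in> {0, 1}"
        using True gen[of y] by (metis insertCI power_0_left)
      moreover have "t ^ 0 \<in> span ?P"
        using \<open>m > 0\<close> by (intro span_base imageI) simp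
      ultimately show ?thesis
        by (auto simp: span_zero)
    next
      case False
      then obtain i where "y / t ^ m = t ^ i"
        using gen[of "y / t ^ m"] by auto
      then have "y = t ^ i * t ^ m"
        using False by (simp add: field_simps)
      then show ?thesis
        using pow by simp
    qed
    then have "span ?P = UNIV"
      by blast
    then have "CARD('k) ^ n = CARD('k) ^ m"
      using card_span_independent[OF that(1)] that(2) assms(2) by simp
    then show False
      using q that(3) by simp
  qed
  {
    case 0
    show ?case
      using notin[of 0] by (simp add: independent_empty)
  next
    case (Suc m)
    let ?P = "(^) t ` {..<m}"
    have P: "independent ?P" "card ?P = m" "t ^ m \<notin> span ?P"
      using Suc by auto
    have eq: "(^) t ` {..<Suc m} = insert (t ^ m) ?P"
      by (auto simp: lessThan_Suc)
    have "t ^ m \<notin> ?P"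
      using P(3) by (rule contrapos_nn) (rule span_base)
    then have "independent ((^) t ` {..<Suc m})" "card ((^) t ` {..<Suc m}) = Suc m"
      unfolding eq using P by (simp_all add: independent_insertI)
    then show ?case
      using notin[of "Suc m"] by simp
  }
qed

text \<open>Seen as polynomials in \<open>t\<close>, the factors have degrees below \<open>a\<close>
  and \<open>b\<close>, so the product has degree at most \<open>a + b - 2\<close>, which is less
  than \<open>c\<close>.\<close>

lemma span_powers_mult:
  assumes "x \<in> span ((^) t ` {..<a})" "y \<in> span ((^) t ` {..<b})" "a + b \<le> Suc c"
  shows "x * y \<in> span ((^) t ` {..<c})"
  using assms(1)
proof (induction rule: span_induct_alt)
  case (step r x z)
  then obtain i where i: "i < a" "x = t ^ i"
    by auto
  have "x * y \<in> span ((^) t ` {..<c})"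
    using assms(2)
  proof (induction rule: span_induct_alt)
    case (step s y w)
    then obtain j where j: "j < b" "y = t ^ j"
      by auto
    have "t ^ (i + j) \<in> span ((^) t ` {..<c})"
      by (rule span_base) (use i j assms(3) in auto)
    then have "\<iota> s * t ^ (i + j) + x * w \<in> span ((^) t ` {..<c})"
      using step by (intro span_add span_scale)
    then show ?case
      by (simp add: i j power_add algebra_simps)
  qed (simp add: span_zero)
  then have "\<iota> r * (x * y) + z * y \<in> span ((^) t ` {..<c})"
    using step by (intro span_add span_scale)
  then show ?case
    by (simp add: algebra_simps)
qed (simp add: span_zero)

lemma large_clique_exists:
  assumes "CARD('a) = CARD('k) ^ n" "n \<ge> 2"
  shows "\<exists>U C. subspace U \<and> U \<noteq> UNIV \<and> clique C (product_graph_edges U) \<and>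
    card C = CARD('k) ^ (n div 2) + n mod 2"
proof -
  have q: "CARD('k) > 1"
    using card_mono[of UNIV "{0, 1::'k}"] by simp
  obtain t :: 'a where t: "\<And>x. x \<noteq> 0 \<Longrightarrow> \<exists>i::nat. x = t ^ i"
    using finite_field_has_primitive_element by blast
  let ?S = "\<lambda>m. span ((^) t ` {..<m})"
  have card: "card (?S m) = CARD('k) ^ m" if "m \<le> n" for m
    using power_basis[OF t assms(1) that] card_span_independent by simp
  have "card (?S (n - 1)) \<noteq> CARD('a)"
    using card[of "n - 1"] assms q by simp
  then have proper: "?S (n - 1) \<noteq> UNIV"
    by metis
  define m where "m = n div 2"
  have m: "m < n" "m + m \<le> Suc (n - 1)"
    using assms(2) by (auto simp: m_def)
  have new: "t ^ m \<notin> ?S m"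
    using power_basis[OF t assms(1)] m(1) by simp
  \<comment> \<open>A clique constrains only distinct vertices, so for odd \<open>n\<close> the
    square of \<open>t ^ m\<close>, which is \<open>t ^ (n - 1)\<close>, may lie outside the
    subspace.\<close>
  define C where "C = ?S m \<union> (if odd n then {t ^ m} else {})"
  have mult: "x * y \<in> ?S (n - 1)" if "x \<in> ?S m" "y \<in> ?S m" for x y
    using span_powers_mult[OF that m(2)] .
  have mult': "x * t ^ m \<in> ?S (n - 1)" if "x \<in> ?S m" "odd n" for x
  proof (rule span_powers_mult[OF that(1)])
    show "t ^ m \<in> ?S (Suc m)"
      by (rule span_base) simp
    show "m + Suc m \<le> Suc (n - 1)"
      using that(2) by (auto simp: m_def elim!: oddE)
  qed
  then have mult'': "t ^ m * x \<in> ?S (n - 1)" if "x \<in> ?S m" "odd n" for x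
    using that by (metis mult.commute)
  have "clique C (product_graph_edges (?S (n - 1)))"
    unfolding clique_iff C_def using mult mult' mult''
    by (auto split: if_splits)
  moreover have "card C = CARD('k) ^ m + n mod 2"
    using card[of m] m new by (auto simp: C_def odd_iff_mod_2_eq_one even_iff_mod_2_eq_zero)
  ultimately show ?thesis
    unfolding m_def using proper subspace_span by blast
qed

end

section \<open>Orthonormal bases over the field with two elements\<close>

context field_functional
begin

definition orthonormal :: "'b set \<Rightarrow> bool" where
  "orthonormal E \<longleftrightarrow> (\<forall>a\<in>E. \<forall>b\<in>E. f (a * b) = (if a = b then 1 else 0))"

text \<open>In characteristic 2 squaring is injective, hence surjective on a finite field, so a
  vector on which \<open>f\<close> is nonzero is a square.\<close>

lemma anisotropic_exists:
  assumes "CARD('a) = 2"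
  shows "\<exists>e. f (e * e) = 1"
proof -
  have one_or_zero: "c = 0 \<or> c = 1" for c :: 'a
    using assms card_mono[of UNIV "{0, 1, c}"] by (auto simp: card_insert_if split: if_splits)
  have "(1::'a) + 1 = 0"
    using one_or_zero[of "1 + 1"] add_left_cancel[of "1::'a" 1 0] by auto
  then have "\<iota> (1 + 1) = \<iota> 0"
    by simp
  moreover have "\<iota> 0 = 0"
    using hom_add[of 0 0] by (metis add_cancel_right_right)
  ultimately have two: "(1::'b) + 1 = 0"
    by (simp only: hom_add hom_one)
  have "inj (\<lambda>x::'b. x * x)"
  proof (rule injI)
    fix x y :: 'b assume "x * x = y * y"
    moreover have "(x - y) * (x - y) = x * x - y * y - (1 + 1) * (y * (x - y))"
      by (simp add: algebra_simps)
    ultimately have "(x - y) * (x - y) = 0"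
      by (simp only: two) simp
    then show "x = y"
      by simp
  qed
  then have surj: "surj (\<lambda>x::'b. x * x)"
    by (simp add: finite_UNIV_inj_surj)
  obtain z where z: "f z \<noteq> 0"
    using f_nonzero by blast
  obtain e where "z = e * e"
    using surjD[OF surj] by blast
  with z one_or_zero[of "f z"] show ?thesis
    by auto
qed

text \<open>If the form is alternating on the orthogonal complement of \<open>E\<close>, a member \<open>e\<close> of \<open>E\<close> and a
  hyperbolic pair \<open>u, v\<close> of the complement are traded for \<open>e + u, e + v, e + u + v\<close>.\<close>

lemma orthonormal_enlarge:
  assumes "CARD('a) = 2" "CARD('b) = CARD('a) ^ n" "orthonormal E" "card E < n"
  shows "\<exists>E'. orthonormal E' \<and> card E < card E'"
proof -
  have one_or_zero: "c = 0 \<or> c = 1" for c :: 'a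
    using assms(1) card_mono[of UNIV "{0, 1, c}"] by (auto simp: card_insert_if split: if_splits)
  have two: "(1::'a) + 1 = 0"
    using one_or_zero[of "1 + 1"] add_left_cancel[of "1::'a" 1 0] by auto
  have on: "f (a * b) = (if a = b then 1 else 0)" if "a \<in> E" "b \<in> E" for a b
    using that assms(3) by (simp add: orthonormal_def)
  define Perp where "Perp = {x. \<forall>e\<in>E. f (x * e) = 0}"
  have perp: "f (x * e) = 0" "f (e * x) = 0" if "x \<in> Perp" "e \<in> E" for x e
    using that by (auto simp: Perp_def mult.commute)
  show ?thesis
  proof (cases "\<exists>x\<in>Perp. f (x * x) \<noteq> 0")
    case True
    then obtain x where x: "x \<in> Perp" "f (x * x) = 1"
      using one_or_zero by blast
    have "x \<notin> E"
      using x perp(1)[of x x] by auto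
    moreover have "orthonormal (insert x E)"
      unfolding orthonormal_def using x perp on \<open>x \<notin> E\<close> by auto
    ultimately show ?thesis
      by (intro exI[of _ "insert x E"]) simp
  next
    case False
    then have alt: "f (x * x) = 0" if "x \<in> Perp" for x
      using that by blast
    \<comment> \<open>For empty \<open>E\<close> the complement is the whole space, which contains
      an anisotropic vector.\<close>
    have "E \<noteq> {}"
      using alt anisotropic_exists[OF assms(1)] by (auto simp: Perp_def)
    then obtain e where e: "e \<in> E"
      by blast
    \<comment> \<open>Pigeonhole: there are only \<open>2 ^ card E\<close> patterns of products with
      \<open>E\<close>, fewer than vectors. Two vectors with the same pattern differ by a nonzero
      element of \<open>Perp\<close>.\<close>
    obtain u where u: "u \<in> Perp" "u \<noteq> 0"
    proof -
      let ?h = "\<lambda>x. restrict (\<lambda>e. f (x * e)) E"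
      have "\<not> inj ?h"
      proof
        assume "inj ?h"
        then have "CARD('b) \<le> card (E \<rightarrow>\<^sub>E (UNIV :: 'a set))"
          by (intro card_inj_on_le[of ?h]) (auto intro: finite_PiE)
        then show False
          using assms by (simp add: card_funcsetE)
      qed
      then obtain x y where xy: "?h x = ?h y" "x \<noteq> y"
        by (auto simp: inj_def)
      have "f (x * e) = f (y * e)" if "e \<in> E" for e
        using fun_cong[OF xy(1), of e] that by simp
      then have "x - y \<in> Perp"
        by (simp add: Perp_def left_diff_distrib f_diff)
      with xy(2) that show ?thesis
        by simp
    qed
    obtain v0 where "f (v0 * u) \<noteq> 0"
      using nondegenerate[of u] u(2) by blast
    then have v0: "f (v0 * u) = 1"
      using one_or_zero by blast
    \<comment> \<open>The Gram-Schmidt correction of \<open>v0\<close>; its product with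
      \<open>u\<close> is unchanged because \<open>u\<close> is orthogonal to
      \<open>E\<close>.\<close>
    define v where "v = v0 - (\<Sum>a\<in>E. \<iota> (f (v0 * a)) * a)"
    have v_mult: "f (v * x) = f (v0 * x) - (\<Sum>a\<in>E. f (v0 * a) * f (a * x))" for x
      by (simp add: v_def left_diff_distrib f_diff sum_distrib_right f_sum f_scale_mult)
    have "f (v * b) = 0" if "b \<in> E" for b
    proof -
      have "(\<Sum>a\<in>E. f (v0 * a) * f (a * b)) = (\<Sum>a\<in>E. if a = b then f (v0 * b) else 0)"
        by (intro sum.cong) (auto simp: on that)
      then show ?thesis
        using that by (simp add: v_mult)
    qed
    then have v: "v \<in> Perp"
      by (simp add: Perp_def)
    have vu: "f (v * u) = 1" "f (u * v) = 1"
      using v0 perp(2)[OF u(1)] by (simp_all add: v_mult mult.commute[of u])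
    define R where "R = {e + u, e + v, e + (u + v)}"
    have sq: "f (e * e) = 1" "f (u * u) = 0" "f (v * v) = 0" "f (e * u) = 0" "f (u * e) = 0"
      "f (e * v) = 0" "f (v * e) = 0"
      using on[OF e e] alt u(1) v perp e by auto
    have "u \<noteq> v"
      using vu sq by auto
    moreover have "v \<noteq> 0"
      using vu f_0 by auto
    ultimately have cardR: "card R = 3"
      using u(2) by (simp add: R_def)
    have "f (2 * x) = (1 + 1) * f x" for x
      by (simp only: mult_2 f_add distrib_right mult_1)
    with two have two': "(2::'a) = 0" "f (2 * x) = 0" for x
      by simp_all
    \<comment> \<open>Distinct members pair to 1 from \<open>e\<close> plus 1 from
      \<open>u, v\<close>, which is 0 in characteristic 2; in the square of
      \<open>e + (u + v)\<close> the two cross terms cancel.\<close>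
    have onR: "f (a * b) = (if a = b then 1 else 0)" if "a \<in> R" "b \<in> R" for a b
      using that \<open>u \<noteq> v\<close> \<open>v \<noteq> 0\<close> u(2) unfolding R_def
      by (auto simp: distrib_left distrib_right f_add sq vu two')
    have cross: "f (a * b) = 0" "f (b * a) = 0" if "a \<in> R" "b \<in> E - {e}" for a b
      using that e on perp[OF u(1)] perp[OF v] unfolding R_def
      by (auto simp: distrib_left distrib_right f_add)
    \<comment> \<open>A common vector would be orthogonal to itself and yet have square value
      1.\<close>
    have disj: "R \<inter> (E - {e}) = {}"
    proof (rule ccontr)
      assume "R \<inter> (E - {e}) \<noteq> {}"
      then obtain a where "a \<in> R" "a \<in> E - {e}"
        by blast
      then show False
        using cross(1)[of a a] onR[of a a] by simp
    qed
    have "orthonormal (R \<union> (E - {e}))"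
      unfolding orthonormal_def
    proof (intro ballI)
      fix a b assume "a \<in> R \<union> (E - {e})" "b \<in> R \<union> (E - {e})"
      then show "f (a * b) = (if a = b then 1 else 0)"
        using disj onR[of a b] cross[of a b] cross[of b a] on[of a b] by auto
    qed
    moreover have "card (R \<union> (E - {e})) = 3 + (card E - 1)"
      using disj e by (subst card_Un_disjoint) (simp_all add: cardR)
    ultimately show ?thesis
      by (intro exI[of _ "R \<union> (E - {e})"]) simp
  qed
qed

lemma orthonormal_basis_exists:
  assumes "CARD('a) = 2" "CARD('b) = CARD('a) ^ n"
  shows "\<exists>E. orthonormal E \<and> n \<le> card E"
proof -
  have "\<exists>E. orthonormal E \<and> m \<le> card E" if "m \<le> n" for m
    using that
  proof (induction m)
    case 0
    show ?case
      by (intro exI[of _ "{}"]) (simp add: orthonormal_def)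
  next
    case (Suc m)
    then obtain E where E: "orthonormal E" "m \<le> card E"
      by auto
    show ?case
    proof (cases "Suc m \<le> card E")
      case True
      with E show ?thesis by blast
    next
      case False
      with Suc.prems have "card E < n"
        by simp
      with orthonormal_enlarge[OF assms E(1)] E(2) show ?thesis
        by (meson Suc_leI le_less_trans)
    qed
  qed
  then show ?thesis
    by blast
qed

lemma orthonormal_clique:
  assumes "orthonormal E"
  shows "clique (insert 0 E) (product_graph_edges {x. f x = 0})" "card (insert 0 E) = card E + 1"
proof -
  show "clique (insert 0 E) (product_graph_edges {x. f x = 0})"
    using assms by (auto simp: clique_iff orthonormal_def f_0)
  have "0 \<notin> E"
    using assms f_0 unfolding orthonormal_def by (metis mult_zero_left zero_neq_one)
  then show "card (insert 0 E) = card E + 1"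
    by simp
qed

end

lemma (in finite_field_extension) orthonormal_clique_exists:
  assumes "CARD('k) = 2" "CARD('a) = CARD('k) ^ n"
  shows "\<exists>U C. subspace U \<and> U \<noteq> UNIV \<and> clique C (product_graph_edges U) \<and> n + 1 \<le> card C"
proof -
  \<comment> \<open>Any nonzero functional serves; the zero subspace, being proper, supplies
    one.\<close>
  have "{0} \<noteq> (UNIV :: 'a set)"
    by (rule notI, drule eqset_imp_iff[of _ _ 1]) simp
  then obtain f where "field_functional \<iota> f"
    using proper_subspace_in_kernel[OF subspace_single_0] by blast
  then interpret F: field_functional \<iota> f .
  obtain E where E: "F.orthonormal E" "n \<le> card E"
    using F.orthonormal_basis_exists[OF assms] by blast
  have "subspace {x. f x = 0}"
    by (rule subspaceI) (simp_all add: F.f_0 F.f_add F.f_scale)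
  moreover have "{x. f x = 0} \<noteq> UNIV"
    using F.f_nonzero by blast
  ultimately show ?thesis
    using F.orthonormal_clique[OF E(1)] E(2)
    by (intro exI[of _ "{x. f x = 0}"] exI[of _ "insert 0 E"]) simp
qed

section \<open>Optimising \<open>q ^ d + k\<close> under \<open>2 * d + k \<le> n\<close>\<close>

text \<open>Raising \<open>d\<close> by \<open>j\<close> to \<open>n div 2\<close> costs at most
  \<open>2 * j\<close> in \<open>k\<close>, while \<open>q ^ d\<close> grows by the factor
  \<open>q ^ j\<close>. The gain outweighs the loss because \<open>1 + 2 * j \<le> 3 ^ j\<close>;
  for \<open>q = 2\<close> a finer argument is made.\<close>

lemma clique_size_bound_large:
  fixes q n d k :: nat
  assumes "q \<ge> 2" "q > 2 \<or> n \<ge> 6" "2 * d + k \<le> n"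
  shows "q ^ d + k \<le> q ^ (n div 2) + n mod 2"
proof -
  define m where "m = n div 2"
  have "d \<le> m"
    using assms(3) by (simp add: m_def)
  then obtain j where j: "m = d + j"
    by (auto simp: le_iff_add)
  have k: "k \<le> 2 * j + n mod 2"
    using assms(3) j unfolding m_def by presburger
  have lin: "1 + 2 * j \<le> 3 ^ j" for j :: nat
    by (induction j) auto
  have "q ^ d + 2 * j \<le> q ^ m"
  proof (cases "q > 2")
    case True
    then have "1 + 2 * j \<le> q ^ j"
      using lin[of j] power_mono[of 3 q j] by simp
    then have "q ^ d * (1 + 2 * j) \<le> q ^ m"
      unfolding j power_add by (rule mult_left_mono) simp
    moreover have "1 * (2 * j) \<le> q ^ d * (2 * j)"
      by (rule mult_right_mono) (use assms(1) in simp_all)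
    ultimately show ?thesis
      by (simp only: distrib_left)
  next
    case False
    then have q: "q = 2" and "m \<ge> 3"
      using assms by (auto simp: m_def)
    have exp: "1 + j \<le> 2 ^ j" for j :: nat
      by (induction j) auto
    show ?thesis
    proof (cases d)
      case 0
      \<comment> \<open>Here \<open>n \<ge> 6\<close> is decisive: the inequality fails for
        \<open>m = 1\<close> and \<open>m = 2\<close>.\<close>
      have "1 + 2 * m \<le> 2 ^ m"
        using \<open>m \<ge> 3\<close> by (induction m rule: dec_induct) auto
      then show ?thesis
        using 0 j q by simp
    next
      case (Suc d')
      \<comment> \<open>For positive \<open>d\<close> the factor 2 split off from
        \<open>2 ^ d\<close> turns the weaker estimate \<open>1 + j \<le> 2 ^ j\<close> into a gain
        of \<open>2 * j\<close>.\<close>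
      have "2 * 2 ^ d' * (1 + j) \<le> 2 ^ m"
        unfolding j Suc power_add power_Suc using exp[of j] by (intro mult_left_mono) simp_all
      moreover have "1 * (2 * j) \<le> 2 ^ d' * (2 * j)"
        by (rule mult_right_mono) simp_all
      moreover have "2 * 2 ^ d' * (1 + j) = 2 * 2 ^ d' + 2 ^ d' * (2 * j)"
        by (simp add: algebra_simps)
      ultimately have "2 * 2 ^ d' + 2 * j \<le> 2 ^ m"
        by linarith
      then show ?thesis
        by (simp add: q Suc)
    qed
  qed
  with k show ?thesis
    by (simp add: m_def)
qed

text \<open>For \<open>n \<le> 5\<close> only \<open>d \<le> 2\<close> occurs, and there
  \<open>2 ^ d \<le> 2 * d + 1\<close>.\<close>

lemma clique_size_bound_small:
  fixes n d k :: nat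
  assumes "n \<le> 5" "2 * d + k \<le> n"
  shows "2 ^ d + k \<le> n + 1"
proof -
  have "d = 0 \<or> d = 1 \<or> d = 2"
    using assms by linarith
  then show ?thesis
    using assms by auto
qed

section \<open>Combination of the bounds with the extremal cliques\<close>

theorem theorem2p3:
  fixes \<iota> :: "'k::{field,finite} \<Rightarrow> 'a::{field,finite}"
    and q n :: nat
  assumes "primepow q" and "n \<ge> 2"
    and "CARD('k) = q" and "CARD('a) = q ^ n"
    and "\<iota> 1 = 1"
    and "\<And>x y. \<iota> (x + y) = \<iota> x + \<iota> y"
    and "\<And>x y. \<iota> (x * y) = \<iota> x * \<iota> y"
  shows "(q = 2 \<and> n \<in> {2, 3, 4, 5} \<longrightarrow> max_product_clique_number \<iota> = n + 1) \<and>
         (q > 2 \<or> n \<ge> 6 \<longrightarrow>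
            (odd n \<longrightarrow> max_product_clique_number \<iota> = q ^ ((n - 1) div 2) + 1) \<and>
            (even n \<longrightarrow> max_product_clique_number \<iota> = q ^ (n div 2)))"
proof -
  interpret finite_field_extension \<iota>
    by unfold_locales (use assms in auto)
  have card: "CARD('a) = CARD('k) ^ n"
    using assms(3,4) by simp
  have q: "q \<ge> 2"
    using card_mono[of UNIV "{0, 1::'k}"] assms(3) by simp
  have small: "max_product_clique_number \<iota> = n + 1" if q2: "q = 2" and n5: "n \<le> 5"
  proof -
    obtain U C where UC: "subspace U" "U \<noteq> UNIV" "clique C (product_graph_edges U)" "n + 1 \<le> card C"
      using orthonormal_clique_exists[OF _ card] q2 assms(3) by blast
    show ?thesis
    proof (rule max_product_clique_number_eqI[OF _ UC])
      fix U C assume "subspace U" "U \<noteq> UNIV" "clique C (product_graph_edges U)"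
      from clique_bound[OF card this] obtain d k where "2 * d + k \<le> n" "card C \<le> 2 ^ d + k"
        using assms(3) q2 by auto
      then show "card C \<le> n + 1"
        using clique_size_bound_small[OF n5] order_trans by blast
    qed
  qed
  have large: "max_product_clique_number \<iota> = q ^ (n div 2) + n mod 2" if large: "q > 2 \<or> n \<ge> 6"
  proof -
    obtain U C where UC: "subspace U" "U \<noteq> UNIV" "clique C (product_graph_edges U)"
      "q ^ (n div 2) + n mod 2 \<le> card C"
      using large_clique_exists[OF card assms(2)] assms(3) by (metis order_refl)
    show ?thesis
    proof (rule max_product_clique_number_eqI[OF _ UC])
      fix U C assume "subspace U" "U \<noteq> UNIV" "clique C (product_graph_edges U)"
      from clique_bound[OF card this] obtain d k where "2 * d + k \<le> n" "card C \<le> q ^ d + k"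
        using assms(3) by auto
      then show "card C \<le> q ^ (n div 2) + n mod 2"
        using clique_size_bound_large[OF q large] order_trans by blast
    qed
  qed
  \<comment> \<open>This splits the uniform value \<open>q ^ (n div 2) + n mod 2\<close> by
    parity.\<close>
  have "(n - 1) div 2 = n div 2" "n mod 2 = 1" if "odd n"
    using that by (auto elim!: oddE)
  then show ?thesis
    using small large by auto
qed

end
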